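(* Let $K$ be a multiplicative group isomorphic to the additive group of $\mathbb{F}_q$, let $G=\{g_0=1,g_1,\dots,g_{v-1}\}$ be a finite group of order $v$ with $q\mid v$, and let $\psi:G\times G\to K$ be a normalized cocycle. If $\psi$ is orthogonal, then $C=(\Phi(E_\psi),\star)$ is a generalized Hadamard full propelinear code (GHFP-code), where $x\star y=\Phi\big(\Phi^{-1}(x)\cdot\Phi^{-1}(y)\big)$ for $x,y\in\Phi(E_\psi)$, and $K^v$ is identified with $\mathbb{F}_q^v$ via a fixed isomorphism $\mathbb{F}_q\cong K$.
   Context: Cocycles. A normalized cocycle is a map $\psi:G\times G\to K$ with $\psi(g,h)\psi(gh,k)=\psi(g,hk)\psi(h,k)$ and $\psi(g,1)=\psi(1,g)=1$ for all $g,h,k\in G$. It is orthogonal if for each $g\ne1$ in $G$ and each $u\in K$, $|\{h\in G:\psi(g,h)=u\}|=v/q$. The extension group $E_\psi$ is the set $\{(u,g):u\in K,g\in G\}$ with product $(u,g)(w,h)=(uw\,\psi(g,h),gh)$. Put $T(\psi)=\{t_j=(1,g_j):0\le j\le v-1\}$. The map $\Phi$. $\Phi:E_\psi\to K^v$ is defined by: for $(k,g)\in E_\psi$, the $j$-th entry of $\Phi(k,g)$ is the unique $l\in K$ with $(k,g)^{-1}t_j\in T(\psi)(l,1)$. Equivalently $[\Phi(k,g)]_j=(k\,\psi(g,g^{-1}))^{-1}\psi(g^{-1},g_j)$. The map $\Phi$ is injective, and $\Phi^{-1}$ denotes its inverse on its image. Generalized Hadamard codes. A $v\times v$ matrix $H=(h_{ij})$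 over the additive group $\mathbb{F}_q$ is a generalized Hadamard matrix $\mathrm{GH}(q,v/q)$ if for all $i<j$ the multiset $\{h_{ik}-h_{jk}:1\le k\le v\}$ contains each element of $\mathbb{F}_q$ exactly $v/q$ times; it is normalized if its first row and column are zero. For a normalized $H$, $F_H$ is the set of rows of $H$ and $C_H=\bigcup_{\alpha\in\mathbb{F}_q}(F_H+\alpha\mathbf 1)$, with $\mathbf 1$ the all-one vector, is called a generalized Hadamard code. Full propelinear codes. For $\pi\in\mathcal{S}_n$ and $y\in\mathbb{F}_q^n$, $\pi(y)=(y_{\pi^{-1}(1)},\dots,y_{\pi^{-1}(n)})$. A code $C\subseteq\mathbb{F}_q^n$ with $\mathbf 0\in C$ and operation $\star$ is full propelinear if to every $x\in C$ is assigned $\pi_x\in\mathcal{S}_n$ such that $x\star y=x+\pi_x(y)$ and: (i) $x\star C=C$ for all $x\in C$; (ii) $\pi_{x\star y}=\pi_x\circ\pi_y$ for all $x,y\in C$; (iii) $\pi_x$ fixes no coordinate if $x\notin\{\alpha\mathbf 1:\alpha\in\mathbb{F}_q\}$, and $\pi_x=\mathrm{Id}$ if $x=\alpha\mathbf 1$ for some $\alpha\in\mathbb{F}_q$. A GHFP-code is a generalized Hadamard code that is full propelinear. *)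

theory Defs
  imports
    "HOL-Library.Cardinality"
    "HOL-Algebra.Coset"
    "HOL-Combinatorics.Permutations"
    "Jordan_Normal_Form.Matrix"
begin

section \<open>Cocycles and the map \<open>\<Phi>\<close>\<close>

definition additive_group :: "'f::ab_group_add monoid" where
  "additive_group = \<lparr>carrier = UNIV, monoid.mult = (+), one = 0\<rparr>"

definition normalized_cocycle ::
  "('g, 'b) monoid_scheme \<Rightarrow> ('k, 'c) monoid_scheme \<Rightarrow> ('g \<Rightarrow> 'g \<Rightarrow> 'k) \<Rightarrow> bool" where
  "normalized_cocycle G K \<psi> \<longleftrightarrow>
     (\<forall>g\<in>carrier G. \<forall>h\<in>carrier G. \<psi> g h \<in> carrier K) \<and>
     (\<forall>g\<in>carrier G. \<forall>h\<in>carrier G. \<forall>k\<in>carrier G.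
        \<psi> g h \<otimes>\<^bsub>K\<^esub> \<psi> (g \<otimes>\<^bsub>G\<^esub> h) k = \<psi> g (h \<otimes>\<^bsub>G\<^esub> k) \<otimes>\<^bsub>K\<^esub> \<psi> h k) \<and>
     (\<forall>g\<in>carrier G. \<psi> g \<one>\<^bsub>G\<^esub> = \<one>\<^bsub>K\<^esub> \<and> \<psi> \<one>\<^bsub>G\<^esub> g = \<one>\<^bsub>K\<^esub>)"

text \<open>The quotient \<open>v / q\<close> is written with natural-number division, so this is the intended
  notion when the order of \<open>K\<close> divides the order of \<open>G\<close>.\<close>

definition orthogonal_cocycle ::
  "('g, 'b) monoid_scheme \<Rightarrow> ('k, 'c) monoid_scheme \<Rightarrow> ('g \<Rightarrow> 'g \<Rightarrow> 'k) \<Rightarrow> bool" where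
  "orthogonal_cocycle G K \<psi> \<longleftrightarrow>
     (\<forall>g\<in>carrier G - {\<one>\<^bsub>G\<^esub>}. \<forall>u\<in>carrier K.
        card {h \<in> carrier G. \<psi> g h = u} = card (carrier G) div card (carrier K))"

definition ext_group ::
  "('g, 'b) monoid_scheme \<Rightarrow> ('k, 'c) monoid_scheme \<Rightarrow> ('g \<Rightarrow> 'g \<Rightarrow> 'k) \<Rightarrow> ('k \<times> 'g) monoid" where
  "ext_group G K \<psi> =
     \<lparr>carrier = carrier K \<times> carrier G,
      monoid.mult = (\<lambda>(u, g) (w, h). (u \<otimes>\<^bsub>K\<^esub> w \<otimes>\<^bsub>K\<^esub> \<psi> g h, g \<otimes>\<^bsub>G\<^esub> h)),
      one = (\<one>\<^bsub>K\<^esub>, \<one>\<^bsub>G\<^esub>)\<rparr>"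

text \<open>The group \<open>G\<close> comes with an enumeration \<open>gs 0, \<dots>, gs (v - 1)\<close>, where
  \<open>v = card (carrier G)\<close>.\<close>

definition transversal ::
  "('g, 'b) monoid_scheme \<Rightarrow> ('k, 'c) monoid_scheme \<Rightarrow> (nat \<Rightarrow> 'g) \<Rightarrow> ('k \<times> 'g) set" where
  "transversal G K gs = {(\<one>\<^bsub>K\<^esub>, gs j) | j. j < card (carrier G)}"

definition Phi ::
  "('g, 'b) monoid_scheme \<Rightarrow> ('k, 'c) monoid_scheme \<Rightarrow> ('g \<Rightarrow> 'g \<Rightarrow> 'k) \<Rightarrow> (nat \<Rightarrow> 'g)
     \<Rightarrow> 'k \<times> 'g \<Rightarrow> 'k vec" where
  "Phi G K \<psi> gs x = vec (card (carrier G)) (\<lambda>j. THE l. l \<in> carrier K \<and>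
     inv\<^bsub>ext_group G K \<psi>\<^esub> x \<otimes>\<^bsub>ext_group G K \<psi>\<^esub> (\<one>\<^bsub>K\<^esub>, gs j)
       \<in> transversal G K gs #>\<^bsub>ext_group G K \<psi>\<^esub> (l, \<one>\<^bsub>G\<^esub>))"

text \<open>An isomorphism \<open>\<theta>\<close> from the additive group of the field to \<open>K\<close> identifies
  \<open>K\<^sup>v\<close> with the space of \<open>v\<close>-dimensional vectors over the field, entry by entry. The code and
  its operation are transported along this identification.\<close>

definition Phi_code ::
  "('g, 'b) monoid_scheme \<Rightarrow> ('k, 'c) monoid_scheme \<Rightarrow> ('g \<Rightarrow> 'g \<Rightarrow> 'k) \<Rightarrow> (nat \<Rightarrow> 'g)
     \<Rightarrow> ('f \<Rightarrow> 'k) \<Rightarrow> 'f vec set" where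
  "Phi_code G K \<psi> gs \<theta> =
     map_vec (inv_into UNIV \<theta>) ` Phi G K \<psi> gs ` carrier (ext_group G K \<psi>)"

definition Phi_star ::
  "('g, 'b) monoid_scheme \<Rightarrow> ('k, 'c) monoid_scheme \<Rightarrow> ('g \<Rightarrow> 'g \<Rightarrow> 'k) \<Rightarrow> (nat \<Rightarrow> 'g)
     \<Rightarrow> ('f \<Rightarrow> 'k) \<Rightarrow> 'f vec \<Rightarrow> 'f vec \<Rightarrow> 'f vec" where
  "Phi_star G K \<psi> gs \<theta> x y =
     (let E = ext_group G K \<psi>; Phi_inv = inv_into (carrier E) (Phi G K \<psi> gs) in
        map_vec (inv_into UNIV \<theta>)
          (Phi G K \<psi> gs (Phi_inv (map_vec \<theta> x) \<otimes>\<^bsub>E\<^esub> Phi_inv (map_vec \<theta> y))))"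

section \<open>Generalized Hadamard codes\<close>

text \<open>Rows, columns and coordinates are indexed from \<open>0\<close>. The alphabet is a finite field
  given as a type.\<close>

definition gen_hadamard :: "nat \<Rightarrow> 'f::{field, finite} mat \<Rightarrow> bool" where
  "gen_hadamard v H \<longleftrightarrow> CARD('f) dvd v \<and> H \<in> carrier_mat v v \<and>
     (\<forall>i j. i < j \<and> j < v \<longrightarrow>
        (\<forall>a. card {k. k < v \<and> H $$ (i, k) - H $$ (j, k) = a} = v div CARD('f)))"

definition normalized_gen_hadamard :: "nat \<Rightarrow> 'f::{field, finite} mat \<Rightarrow> bool" where
  "normalized_gen_hadamard v H \<longleftrightarrow> gen_hadamard v H \<and>
     (\<forall>k<v. H $$ (0, k) = 0) \<and> (\<forall>k<v. H $$ (k, 0) = 0)"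

definition const_vec :: "nat \<Rightarrow> 'f \<Rightarrow> 'f vec" where
  "const_vec n a = vec n (\<lambda>_. a)"

definition hadamard_code :: "nat \<Rightarrow> 'f::{field, finite} mat \<Rightarrow> 'f vec set" where
  "hadamard_code v H = (\<Union>a. {x + const_vec v a | x. x \<in> set (rows H)})"

definition gen_hadamard_code :: "nat \<Rightarrow> 'f::{field, finite} vec set \<Rightarrow> bool" where
  "gen_hadamard_code v C \<longleftrightarrow>
     (\<exists>H. normalized_gen_hadamard v H \<and> C = hadamard_code v H)"

section \<open>Full propelinear codes\<close>

definition permute_vec :: "(nat \<Rightarrow> nat) \<Rightarrow> 'f vec \<Rightarrow> 'f vec" where
  "permute_vec \<pi> y = vec (dim_vec y) (\<lambda>i. y $ inv_into UNIV \<pi> i)"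

definition full_propelinear ::
  "nat \<Rightarrow> 'f::{field, finite} vec set \<Rightarrow> ('f vec \<Rightarrow> 'f vec \<Rightarrow> 'f vec) \<Rightarrow> bool" where
  "full_propelinear n C star \<longleftrightarrow>
     C \<subseteq> carrier_vec n \<and> 0\<^sub>v n \<in> C \<and>
     (\<exists>\<pi>. (\<forall>x\<in>C. \<pi> x permutes {..<n}) \<and>
          (\<forall>x\<in>C. \<forall>y\<in>C. star x y = x + permute_vec (\<pi> x) y) \<and>
          (\<forall>x\<in>C. star x ` C = C) \<and>
          (\<forall>x\<in>C. \<forall>y\<in>C. \<pi> (star x y) = \<pi> x \<circ> \<pi> y) \<and>
          (\<forall>x\<in>C. x \<notin> range (const_vec n) \<longrightarrow> (\<forall>i<n. \<pi> x i \<noteq> i)) \<and>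
          (\<forall>x\<in>C. x \<in> range (const_vec n) \<longrightarrow> \<pi> x = id))"

definition GHFP_code ::
  "nat \<Rightarrow> 'f::{field, finite} vec set \<Rightarrow> ('f vec \<Rightarrow> 'f vec \<Rightarrow> 'f vec) \<Rightarrow> bool" where
  "GHFP_code n C star \<longleftrightarrow> gen_hadamard_code n C \<and> full_propelinear n C star"

end

theory Submission
  imports Defs
begin

text \<open>
  Write \<open>\<phi>\<close> for the cocycle read in the additive group of the field. The entries of
  \<open>\<Phi>(k, g)\<close> are \<open>\<phi>(g\<inverse>, g\<^sub>j)\<close> plus a constant depending on \<open>(k, g)\<close>, and this constant takes
  every value as \<open>k\<close> varies, so the code is the union of the translates of the rows of
  \<open>H = (\<phi>(g\<^sub>i, g\<^sub>j))\<close>. The cocycle identity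
  \<open>\<phi>(gh, x) - \<phi>(h, x) = \<phi>(g, hx) - \<phi>(g, h)\<close> turns orthogonality into the
  statement that the difference of two distinct rows of \<open>H\<close> is balanced; this makes \<open>H\<close>
  generalized Hadamard and \<open>\<Phi>\<close> injective. Finally, \<open>(k, g)\<inverse> t\<^sub>j\<close> lies over
  \<open>g\<inverse> g\<^sub>j\<close>, so multiplication by \<open>(k, g)\<close> permutes coordinates by left translation by
  \<open>g\<close>, which has a fixed point only for \<open>g = 1\<close>.
\<close>

section \<open>The extension group of \<open>K\<close> by \<open>G\<close>\<close>

locale cocycle_extension = G: group G + K: comm_group K
  for G :: "('g, 'b) monoid_scheme" and K :: "('k, 'c) monoid_scheme" +
  fixes \<psi> :: "'g \<Rightarrow> 'g \<Rightarrow> 'k" and gs :: "nat \<Rightarrow> 'g"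
  assumes finite_G: "finite (carrier G)"
    and bij_gs: "bij_betw gs {..<card (carrier G)} (carrier G)"
    and cocycle: "normalized_cocycle G K \<psi>"
begin

abbreviation E :: "('k \<times> 'g) monoid" where
  "E \<equiv> ext_group G K \<psi>"

lemma cocycle_closed [simp]: "g \<in> carrier G \<Longrightarrow> h \<in> carrier G \<Longrightarrow> \<psi> g h \<in> carrier K"
  using cocycle by (auto simp: normalized_cocycle_def)

lemma cocycle_one [simp]:
  "g \<in> carrier G \<Longrightarrow> \<psi> g \<one>\<^bsub>G\<^esub> = \<one>\<^bsub>K\<^esub>" "g \<in> carrier G \<Longrightarrow> \<psi> \<one>\<^bsub>G\<^esub> g = \<one>\<^bsub>K\<^esub>"
  using cocycle by (auto simp: normalized_cocycle_def)

lemma cocycle_assoc: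
  assumes "g \<in> carrier G" "h \<in> carrier G" "k \<in> carrier G"
  shows "\<psi> g h \<otimes>\<^bsub>K\<^esub> \<psi> (g \<otimes>\<^bsub>G\<^esub> h) k = \<psi> g (h \<otimes>\<^bsub>G\<^esub> k) \<otimes>\<^bsub>K\<^esub> \<psi> h k"
  using cocycle assms by (auto simp: normalized_cocycle_def)

lemma gs_closed [simp]: "j < card (carrier G) \<Longrightarrow> gs j \<in> carrier G"
  using bij_gs by (auto simp: bij_betw_def)

lemma gs_surj: "g \<in> carrier G \<Longrightarrow> \<exists>j<card (carrier G). gs j = g"
  using bij_betw_imp_surj_on[OF bij_gs] by force

lemma card_pos: "0 < card (carrier G)"
  using finite_G by (auto simp: card_gt_0_iff)

lemma carrier_E [simp]: "(u, g) \<in> carrier E \<longleftrightarrow> u \<in> carrier K \<and> g \<in> carrier G"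
  by (simp add: ext_group_def)

lemma mult_E [simp]: "(u, g) \<otimes>\<^bsub>E\<^esub> (w, h) = (u \<otimes>\<^bsub>K\<^esub> w \<otimes>\<^bsub>K\<^esub> \<psi> g h, g \<otimes>\<^bsub>G\<^esub> h)"
  by (simp add: ext_group_def)

lemma one_E: "\<one>\<^bsub>E\<^esub> = (\<one>\<^bsub>K\<^esub>, \<one>\<^bsub>G\<^esub>)"
  by (simp add: ext_group_def)

text \<open>The cocycle identity at \<open>(g, inv g, g)\<close>: both factors with an argument
  \<open>1\<close> are trivial.\<close>

lemma cocycle_inv: "g \<in> carrier G \<Longrightarrow> \<psi> (inv\<^bsub>G\<^esub> g) g = \<psi> g (inv\<^bsub>G\<^esub> g)"
  using cocycle_assoc[of g "inv\<^bsub>G\<^esub> g" g] by simp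

lemma inv_mult_E:
  assumes "k \<in> carrier K" "g \<in> carrier G"
  shows "(inv\<^bsub>K\<^esub> (k \<otimes>\<^bsub>K\<^esub> \<psi> g (inv\<^bsub>G\<^esub> g)), inv\<^bsub>G\<^esub> g) \<otimes>\<^bsub>E\<^esub> (k, g) = \<one>\<^bsub>E\<^esub>"
  using assms by (simp add: one_E cocycle_inv K.m_assoc)

lemma group_E: "group E"
proof (rule groupI)
  fix x y z assume "x \<in> carrier E" "y \<in> carrier E" "z \<in> carrier E"
  then obtain a b c g h k where xyz: "x = (a, g)" "y = (b, h)" "z = (c, k)"
    and [simp]: "a \<in> carrier K" "b \<in> carrier K" "c \<in> carrier K"
      "g \<in> carrier G" "h \<in> carrier G" "k \<in> carrier G"
    by (metis carrier_E surj_pair)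
  \<comment> \<open>Commutativity of \<open>K\<close> brings the two cocycle values together, in the
    shape of the cocycle identity.\<close>
  have "a \<otimes>\<^bsub>K\<^esub> b \<otimes>\<^bsub>K\<^esub> \<psi> g h \<otimes>\<^bsub>K\<^esub> c \<otimes>\<^bsub>K\<^esub> \<psi> (g \<otimes>\<^bsub>G\<^esub> h) k
      = a \<otimes>\<^bsub>K\<^esub> (b \<otimes>\<^bsub>K\<^esub> c \<otimes>\<^bsub>K\<^esub> (\<psi> g h \<otimes>\<^bsub>K\<^esub> \<psi> (g \<otimes>\<^bsub>G\<^esub> h) k))"
    by (simp add: K.m_ac)
  also have "\<dots> = a \<otimes>\<^bsub>K\<^esub> (b \<otimes>\<^bsub>K\<^esub> c \<otimes>\<^bsub>K\<^esub> \<psi> h k) \<otimes>\<^bsub>K\<^esub> \<psi> g (h \<otimes>\<^bsub>G\<^esub> k)"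
    by (simp add: cocycle_assoc K.m_ac)
  finally show "x \<otimes>\<^bsub>E\<^esub> y \<otimes>\<^bsub>E\<^esub> z = x \<otimes>\<^bsub>E\<^esub> (y \<otimes>\<^bsub>E\<^esub> z)"
    by (simp add: xyz G.m_assoc)
next
  fix x assume "x \<in> carrier E"
  then obtain k g where "x = (k, g)" "k \<in> carrier K" "g \<in> carrier G"
    by (metis carrier_E surj_pair)
  then show "\<exists>y\<in>carrier E. y \<otimes>\<^bsub>E\<^esub> x = \<one>\<^bsub>E\<^esub>"
    using inv_mult_E[of k g]
    by (intro bexI[of _ "(inv\<^bsub>K\<^esub> (k \<otimes>\<^bsub>K\<^esub> \<psi> g (inv\<^bsub>G\<^esub> g)), inv\<^bsub>G\<^esub> g)"]) auto
qed (auto simp: one_E)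

sublocale E: group E
  by (rule group_E)

lemma inv_E:
  assumes "k \<in> carrier K" "g \<in> carrier G"
  shows "inv\<^bsub>E\<^esub> (k, g) = (inv\<^bsub>K\<^esub> (k \<otimes>\<^bsub>K\<^esub> \<psi> g (inv\<^bsub>G\<^esub> g)), inv\<^bsub>G\<^esub> g)"
  using assms by (intro E.inv_equality inv_mult_E) auto

section \<open>Coordinates of \<open>Phi\<close>\<close>

lemma transversal_coset:
  assumes "l \<in> carrier K"
  shows "transversal G K gs #>\<^bsub>E\<^esub> (l, \<one>\<^bsub>G\<^esub>) = {l} \<times> carrier G"
proof -
  \<comment> \<open>Normalization gives \<open>\<psi> g 1 = 1\<close>, so right multiplication by
    \<open>(l, 1)\<close> changes only the \<open>K\<close>-component.\<close>
  have "transversal G K gs #>\<^bsub>E\<^esub> (l, \<one>\<^bsub>G\<^esub>) = (\<lambda>j. (l, gs j)) ` {..<card (carrier G)}"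
    using assms by (auto simp: transversal_def r_coset_def)
  also have "\<dots> = {l} \<times> carrier G"
    using bij_gs by (auto simp: bij_betw_def)
  finally show ?thesis .
qed

text \<open>The cosets of the transversal are the fibres of the projection of \<open>E\<close> to
  \<open>K\<close>, so the description operator returns the first component.\<close>

lemma Phi_nth_fst:
  assumes "x \<in> carrier E" "j < card (carrier G)"
  shows "Phi G K \<psi> gs x $ j = fst (inv\<^bsub>E\<^esub> x \<otimes>\<^bsub>E\<^esub> (\<one>\<^bsub>K\<^esub>, gs j))"
proof -
  define y where "y = inv\<^bsub>E\<^esub> x \<otimes>\<^bsub>E\<^esub> (\<one>\<^bsub>K\<^esub>, gs j)"
  have "y \<in> carrier E"
    using assms by (auto simp: y_def intro!: E.m_closed)
  then have "(THE l. l \<in> carrier K \<and> y \<in> transversal G K gs #>\<^bsub>E\<^esub> (l, \<one>\<^bsub>G\<^esub>)) = fst y"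
    by (cases y) (auto simp: transversal_coset intro!: the_equality)
  then show ?thesis
    using assms(2) by (simp add: Phi_def y_def)
qed

lemma Phi_nth:
  assumes "k \<in> carrier K" "g \<in> carrier G" "j < card (carrier G)"
  shows "Phi G K \<psi> gs (k, g) $ j
    = inv\<^bsub>K\<^esub> (k \<otimes>\<^bsub>K\<^esub> \<psi> g (inv\<^bsub>G\<^esub> g)) \<otimes>\<^bsub>K\<^esub> \<psi> (inv\<^bsub>G\<^esub> g) (gs j)"
  using assms by (simp add: Phi_nth_fst inv_E)

lemma dim_Phi [simp]: "dim_vec (Phi G K \<psi> gs x) = card (carrier G)"
  by (simp add: Phi_def)

lemma Phi_nth_closed:
  assumes "x \<in> carrier E" "j < card (carrier G)"
  shows "Phi G K \<psi> gs x $ j \<in> carrier K"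
  using assms by (cases x) (simp add: Phi_nth)

text \<open>Because \<open>K\<close> is central in \<open>E\<close>, the \<open>K\<close>-part of \<open>x\<inverse> t\<^sub>j\<close> can be pulled out of
  \<open>(xy)\<inverse> t\<^sub>j = y\<inverse> (x\<inverse> t\<^sub>j)\<close>.\<close>

lemma Phi_mult_nth:
  assumes x: "x \<in> carrier E" and y: "y \<in> carrier E" and j: "j < card (carrier G)"
    and i: "i < card (carrier G)" "gs i = inv\<^bsub>G\<^esub> (snd x) \<otimes>\<^bsub>G\<^esub> gs j"
  shows "Phi G K \<psi> gs (x \<otimes>\<^bsub>E\<^esub> y) $ j = Phi G K \<psi> gs x $ j \<otimes>\<^bsub>K\<^esub> Phi G K \<psi> gs y $ i"
proof -
  define l where "l = Phi G K \<psi> gs x $ j"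
  obtain k g where kg: "x = (k, g)" "k \<in> carrier K" "g \<in> carrier G"
    using x by (metis carrier_E surj_pair)
  obtain m h where mh: "inv\<^bsub>E\<^esub> y = (m, h)" "m \<in> carrier K" "h \<in> carrier G"
    using y by (metis carrier_E surj_pair E.inv_closed)
  have l: "l \<in> carrier K"
    using x j by (simp add: l_def Phi_nth_closed)
  \<comment> \<open>This splits into the central part \<open>l\<close> and the transversal element
    with index \<open>i\<close>.\<close>
  have "inv\<^bsub>E\<^esub> x \<otimes>\<^bsub>E\<^esub> (\<one>\<^bsub>K\<^esub>, gs j) = (l, gs i)"
    using kg j i by (simp add: l_def Phi_nth inv_E)
  then have "inv\<^bsub>E\<^esub> (x \<otimes>\<^bsub>E\<^esub> y) \<otimes>\<^bsub>E\<^esub> (\<one>\<^bsub>K\<^esub>, gs j) = inv\<^bsub>E\<^esub> y \<otimes>\<^bsub>E\<^esub> (l, gs i)"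
    using x y j by (simp add: E.inv_mult_group E.m_assoc)
  then have "Phi G K \<psi> gs (x \<otimes>\<^bsub>E\<^esub> y) $ j = m \<otimes>\<^bsub>K\<^esub> l \<otimes>\<^bsub>K\<^esub> \<psi> h (gs i)"
    using x y j mh by (simp add: Phi_nth_fst)
  moreover have "Phi G K \<psi> gs y $ i = m \<otimes>\<^bsub>K\<^esub> \<psi> h (gs i)"
    using y i(1) mh by (simp add: Phi_nth_fst)
  ultimately show ?thesis
    using l mh i(1) by (simp add: l_def K.m_ac)
qed

section \<open>Left translations of \<open>G\<close> as coordinate permutations\<close>

definition translation :: "'g \<Rightarrow> nat \<Rightarrow> nat" where
  "translation g i = (if i < card (carrier G)
     then inv_into {..<card (carrier G)} gs (g \<otimes>\<^bsub>G\<^esub> gs i) else i)"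

lemma translation_less:
  assumes "g \<in> carrier G" "i < card (carrier G)"
  shows "translation g i < card (carrier G)" and "gs (translation g i) = g \<otimes>\<^bsub>G\<^esub> gs i"
proof -
  have "g \<otimes>\<^bsub>G\<^esub> gs i \<in> gs ` {..<card (carrier G)}"
    using bij_gs assms by (simp add: bij_betw_def)
  from inv_into_into[OF this] f_inv_into_f[OF this]
  show "translation g i < card (carrier G)" "gs (translation g i) = g \<otimes>\<^bsub>G\<^esub> gs i"
    using assms by (auto simp: translation_def)
qed

lemma translation_eqI:
  assumes "g \<in> carrier G" "i < card (carrier G)" "j < card (carrier G)" "gs j = g \<otimes>\<^bsub>G\<^esub> gs i"
  shows "translation g i = j"
  using inj_onD[OF bij_betw_imp_inj_on[OF bij_gs], of "translation g i" j] translation_less[of g i] assms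
  by auto

lemma translation_mult:
  assumes "g \<in> carrier G" "h \<in> carrier G"
  shows "translation (g \<otimes>\<^bsub>G\<^esub> h) = translation g \<circ> translation h"
proof
  fix i
  show "translation (g \<otimes>\<^bsub>G\<^esub> h) i = (translation g \<circ> translation h) i"
  proof (cases "i < card (carrier G)")
    case True
    then show ?thesis
      using assms by (auto intro!: translation_eqI simp: translation_less G.m_assoc)
  qed (simp add: translation_def)
qed

lemma translation_one: "translation \<one>\<^bsub>G\<^esub> = id"
proof
  fix i
  show "translation \<one>\<^bsub>G\<^esub> i = id i"
  proof (cases "i < card (carrier G)")
    case True
    then show ?thesis
      by (simp add: translation_eqI)
  qed (simp add: translation_def)
qed

text \<open>Translation by \<open>inv g\<close> is a two-sided inverse. Outside the index range
  \<open>translation\<close> is the identity, as \<open>permutes\<close> demands.\<close>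

lemma translation_permutes:
  assumes "g \<in> carrier G"
  shows "translation g permutes {..<card (carrier G)}"
proof (rule bij_imp_permutes)
  have "translation (inv\<^bsub>G\<^esub> g) \<circ> translation g = id" "translation g \<circ> translation (inv\<^bsub>G\<^esub> g) = id"
    using assms by (simp_all add: translation_one flip: translation_mult)
  then show "bij_betw (translation g) {..<card (carrier G)} {..<card (carrier G)}"
    using assms
    by (intro bij_betw_byWitness[where f' = "translation (inv\<^bsub>G\<^esub> g)"])
      (auto simp: translation_less fun_eq_iff)
qed (simp add: translation_def)

text \<open>A group acts freely on itself by left multiplication; this gives the condition that no
  coordinate is fixed.\<close>

lemma translation_fixes:
  assumes "g \<in> carrier G" "i < card (carrier G)" "translation g i = i"
  shows "g = \<one>\<^bsub>G\<^esub>"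
  using translation_less(2)[of g i] assms by simp

end

section \<open>Orthogonal cocycles in additive notation\<close>

locale orthogonal_extension = cocycle_extension G K \<psi> gs
  for G :: "('g, 'b) monoid_scheme" and K :: "('k, 'c) monoid_scheme"
    and \<psi> :: "'g \<Rightarrow> 'g \<Rightarrow> 'k" and gs :: "nat \<Rightarrow> 'g" +
  fixes \<theta> :: "'f::{field, finite} \<Rightarrow> 'k"
  assumes iso: "\<theta> \<in> iso additive_group K"
    and dvd: "CARD('f) dvd card (carrier G)"
    and gs_0: "gs 0 = \<one>\<^bsub>G\<^esub>"
    and orthogonal: "orthogonal_cocycle G K \<psi>"
begin

definition \<tau> :: "'k \<Rightarrow> 'f" where
  "\<tau> = inv_into UNIV \<theta>"

definition \<phi> :: "'g \<Rightarrow> 'g \<Rightarrow> 'f" where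
  "\<phi> g h = \<tau> (\<psi> g h)"

text \<open>This parametrizes the code by \<open>E\<close>, so that its properties can be proved by
  computing in the group.\<close>

definition codeword :: "'k \<times> 'g \<Rightarrow> 'f vec" where
  "codeword x = map_vec \<tau> (Phi G K \<psi> gs x)"

lemma \<theta>_bij: "bij_betw \<theta> UNIV (carrier K)"
  using iso by (simp add: iso_def additive_group_def)

lemma \<theta>_add: "\<theta> (a + b) = \<theta> a \<otimes>\<^bsub>K\<^esub> \<theta> b"
  using iso by (simp add: iso_def additive_group_def hom_def)

lemma \<theta>_closed [simp]: "\<theta> a \<in> carrier K"
  using \<theta>_bij by (auto simp: bij_betw_def)

lemma \<tau>_\<theta> [simp]: "\<tau> (\<theta> a) = a"
  using \<theta>_bij by (simp add: \<tau>_def bij_betw_def)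

lemma \<theta>_\<tau> [simp]: "k \<in> carrier K \<Longrightarrow> \<theta> (\<tau> k) = k"
  using \<theta>_bij by (simp add: \<tau>_def bij_betw_def f_inv_into_f)

lemma \<tau>_mult [simp]: "k \<in> carrier K \<Longrightarrow> l \<in> carrier K \<Longrightarrow> \<tau> (k \<otimes>\<^bsub>K\<^esub> l) = \<tau> k + \<tau> l"
  using \<theta>_add[of "\<tau> k" "\<tau> l"] \<tau>_\<theta>[of "\<tau> k + \<tau> l"] by simp

lemma \<tau>_one [simp]: "\<tau> \<one>\<^bsub>K\<^esub> = 0"
  by (metis K.l_one K.one_closed \<tau>_mult add_cancel_right_right)

lemma \<tau>_inv [simp]: "k \<in> carrier K \<Longrightarrow> \<tau> (inv\<^bsub>K\<^esub> k) = - \<tau> k"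
  using \<tau>_mult[of "inv\<^bsub>K\<^esub> k" k] by (simp add: eq_neg_iff_add_eq_0)

lemma \<phi>_one [simp]: "g \<in> carrier G \<Longrightarrow> \<phi> g \<one>\<^bsub>G\<^esub> = 0" "g \<in> carrier G \<Longrightarrow> \<phi> \<one>\<^bsub>G\<^esub> g = 0"
  by (simp_all add: \<phi>_def)

lemma \<phi>_cocycle:
  assumes "g \<in> carrier G" "h \<in> carrier G" "k \<in> carrier G"
  shows "\<phi> g h + \<phi> (g \<otimes>\<^bsub>G\<^esub> h) k = \<phi> g (h \<otimes>\<^bsub>G\<^esub> k) + \<phi> h k"
  using arg_cong[OF cocycle_assoc[OF assms], of \<tau>] assms by (simp add: \<phi>_def)

lemma dim_codeword [simp]: "dim_vec (codeword x) = card (carrier G)"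
  by (simp add: codeword_def)

lemma codeword_nth:
  assumes "k \<in> carrier K" "g \<in> carrier G" "j < card (carrier G)"
  shows "codeword (k, g) $ j = - (\<tau> k + \<phi> g (inv\<^bsub>G\<^esub> g)) + \<phi> (inv\<^bsub>G\<^esub> g) (gs j)"
  using assms by (simp add: codeword_def Phi_nth \<phi>_def)

section \<open>Balanced differences and their consequences\<close>

lemma \<phi>_orthogonal:
  assumes "g \<in> carrier G" "g \<noteq> \<one>\<^bsub>G\<^esub>"
  shows "card {h \<in> carrier G. \<phi> g h = u} = card (carrier G) div CARD('f)"
proof -
  have "{h \<in> carrier G. \<phi> g h = u} = {h \<in> carrier G. \<psi> g h = \<theta> u}"
    unfolding \<phi>_def using assms(1) by (metis \<tau>_\<theta> \<theta>_\<tau> cocycle_closed)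
  then show ?thesis
    using orthogonal assms bij_betw_same_card[OF \<theta>_bij] by (simp add: orthogonal_cocycle_def)
qed

lemma row_difference_balanced:
  assumes [simp]: "a \<in> carrier G" "b \<in> carrier G" and "a \<noteq> b"
  shows "card {x \<in> carrier G. \<phi> a x - \<phi> b x = u} = card (carrier G) div CARD('f)"
proof -
  \<comment> \<open>The element with \<open>g b = a\<close>, so that the cocycle identity at
    \<open>(g, b, x)\<close> relates rows \<open>a\<close> and \<open>b\<close>.\<close>
  define g where "g = a \<otimes>\<^bsub>G\<^esub> inv\<^bsub>G\<^esub> b"
  have [simp]: "g \<in> carrier G"
    by (simp add: g_def)
  have gb: "g \<otimes>\<^bsub>G\<^esub> b = a"
    by (simp add: g_def G.m_assoc)
  have "g \<noteq> \<one>\<^bsub>G\<^esub>"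
    using gb \<open>a \<noteq> b\<close> by auto
  have diff: "\<phi> a x - \<phi> b x = \<phi> g (b \<otimes>\<^bsub>G\<^esub> x) - \<phi> g b" if "x \<in> carrier G" for x
    using \<phi>_cocycle[of g b x] that by (simp add: gb algebra_simps)
  \<comment> \<open>The substitution \<open>y = b x\<close> reduces the count to a single row of
    \<open>\<phi>\<close>, with the target value shifted by \<open>\<phi> g b\<close>.\<close>
  have "bij_betw (\<lambda>x. b \<otimes>\<^bsub>G\<^esub> x) {x \<in> carrier G. \<phi> a x - \<phi> b x = u}
    {y \<in> carrier G. \<phi> g y = u + \<phi> g b}"
    by (rule bij_betw_byWitness[where f' = "\<lambda>y. inv\<^bsub>G\<^esub> b \<otimes>\<^bsub>G\<^esub> y"])
      (auto simp: diff simp flip: G.m_assoc)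
  then show ?thesis
    using \<phi>_orthogonal[of g "u + \<phi> g b"] \<open>g \<noteq> \<one>\<^bsub>G\<^esub>\<close> bij_betw_same_card by fastforce
qed

text \<open>Balance makes every field element occur, and there are at least two. Injectivity and the
  recognition of constant codewords both rest on this.\<close>

lemma row_difference_not_constant:
  assumes "a \<in> carrier G" "b \<in> carrier G" "a \<noteq> b"
  shows "\<exists>j<card (carrier G). \<phi> a (gs j) - \<phi> b (gs j) \<noteq> u"
proof -
  have "(0::'f) \<noteq> 1"
    by simp
  then obtain w where w: "w \<noteq> u"
    by metis
  \<comment> \<open>The count \<open>v div q\<close> is positive because \<open>q\<close> divides
    the positive number \<open>v\<close>.\<close>
  have "card {x \<in> carrier G. \<phi> a x - \<phi> b x = w} > 0"
    using row_difference_balanced[OF assms] dvd card_pos by (simp add: div_greater_zero_iff dvd_imp_le)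
  then obtain x where "x \<in> carrier G" "\<phi> a x - \<phi> b x = w"
    by (auto simp: card_gt_0_iff)
  then show ?thesis
    using gs_surj w by blast
qed

lemma inj_on_codeword: "inj_on codeword (carrier E)"
proof (rule inj_onI)
  fix x y assume "x \<in> carrier E" "y \<in> carrier E" and eq: "codeword x = codeword y"
  then obtain k g l h where xy: "x = (k, g)" "y = (l, h)"
    and in_carrier: "k \<in> carrier K" "l \<in> carrier K" "g \<in> carrier G" "h \<in> carrier G"
    by (metis carrier_E surj_pair)
  \<comment> \<open>Equal codewords force the rows of \<open>inv g\<close> and \<open>inv h\<close>
    to differ by a constant, hence to be the same row.\<close>
  have "\<phi> (inv\<^bsub>G\<^esub> g) (gs j) - \<phi> (inv\<^bsub>G\<^esub> h) (gs j)
      = \<tau> k + \<phi> g (inv\<^bsub>G\<^esub> g) - (\<tau> l + \<phi> h (inv\<^bsub>G\<^esub> h))" if "j < card (carrier G)" for j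
    using arg_cong[OF eq, of "\<lambda>c. c $ j"] that in_carrier
    by (simp add: xy codeword_nth algebra_simps)
  then have "inv\<^bsub>G\<^esub> g = inv\<^bsub>G\<^esub> h"
    using row_difference_not_constant in_carrier by (metis G.inv_closed)
  then have "g = h"
    using in_carrier by (metis G.inv_inv)
  \<comment> \<open>With \<open>g = h\<close>, a single coordinate determines the
    \<open>K\<close>-component; index \<open>0\<close> exists since \<open>G\<close> is
    nonempty.\<close>
  then have "\<tau> k = \<tau> l"
    using arg_cong[OF eq, of "\<lambda>c. c $ 0"] in_carrier card_pos by (simp add: xy codeword_nth)
  then have "k = l"
    using in_carrier by (metis \<theta>_\<tau>)
  with \<open>g = h\<close> show "x = y"
    by (simp add: xy)
qed

lemma codeword_constant_iff:
  assumes "x \<in> carrier E"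
  shows "codeword x \<in> range (const_vec (card (carrier G))) \<longleftrightarrow> snd x = \<one>\<^bsub>G\<^esub>"
proof -
  obtain k g where x: "x = (k, g)" and in_carrier: "k \<in> carrier K" "g \<in> carrier G"
    using assms by (metis carrier_E surj_pair)
  have "g = \<one>\<^bsub>G\<^esub>" if "codeword x = const_vec (card (carrier G)) a" for a
  proof -
    \<comment> \<open>The row of \<open>1\<close> is zero; subtracting it turns a constant codeword
      into a constant difference of two rows.\<close>
    have "\<phi> (inv\<^bsub>G\<^esub> g) (gs j) - \<phi> \<one>\<^bsub>G\<^esub> (gs j) = a + (\<tau> k + \<phi> g (inv\<^bsub>G\<^esub> g))"
      if "j < card (carrier G)" for j
      using arg_cong[OF \<open>codeword x = _\<close>, of "\<lambda>c. c $ j"] that in_carrier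
      by (simp add: x codeword_nth const_vec_def algebra_simps)
    then have "inv\<^bsub>G\<^esub> g = \<one>\<^bsub>G\<^esub>"
      using row_difference_not_constant in_carrier by (metis G.inv_closed G.one_closed)
    then show ?thesis
      using in_carrier by (metis G.inv_inv G.inv_one)
  qed
  moreover have "codeword x = const_vec (card (carrier G)) (- \<tau> k)" if "g = \<one>\<^bsub>G\<^esub>"
    using that in_carrier by (intro eq_vecI) (auto simp: x codeword_nth const_vec_def)
  ultimately show ?thesis
    by (auto simp: x)
qed

section \<open>The operation on codewords\<close>

lemma Phi_code_eq: "Phi_code G K \<psi> gs \<theta> = codeword ` carrier E"
  by (simp add: Phi_code_def codeword_def \<tau>_def image_image)

lemma map_vec_codeword: "x \<in> carrier E \<Longrightarrow> map_vec \<theta> (codeword x) = Phi G K \<psi> gs x"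
  by (intro eq_vecI) (auto simp: codeword_def Phi_nth_closed)

lemma inj_on_Phi: "inj_on (Phi G K \<psi> gs) (carrier E)"
  using inj_on_codeword by (auto simp: inj_on_def codeword_def)

text \<open>By injectivity of \<open>Phi\<close>, the \<open>inv_into\<close> in
  \<open>Phi_star\<close> recovers \<open>x\<close> and \<open>y\<close> themselves.\<close>

lemma Phi_star_codeword:
  assumes "x \<in> carrier E" "y \<in> carrier E"
  shows "Phi_star G K \<psi> gs \<theta> (codeword x) (codeword y) = codeword (x \<otimes>\<^bsub>E\<^esub> y)"
  using assms inj_on_Phi
  by (simp add: Phi_star_def map_vec_codeword Let_def flip: \<tau>_def codeword_def)

lemma codeword_mult:
  assumes x: "x \<in> carrier E" and y: "y \<in> carrier E"
  shows "codeword (x \<otimes>\<^bsub>E\<^esub> y) = codeword x + permute_vec (translation (snd x)) (codeword y)"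
proof (rule eq_vecI)
  fix j assume "j < dim_vec (codeword x + permute_vec (translation (snd x)) (codeword y))"
  then have j: "j < card (carrier G)"
    by (simp add: permute_vec_def)
  have g: "snd x \<in> carrier G"
    using x by (cases x) simp
  \<comment> \<open>The index of \<open>inv (snd x) * gs j\<close>: the coordinate that
    \<open>permute_vec\<close> reads at position \<open>j\<close>, and the one occurring in
    \<open>Phi_mult_nth\<close>.\<close>
  define i where "i = translation (inv\<^bsub>G\<^esub> (snd x)) j"
  have i: "i < card (carrier G)" "gs i = inv\<^bsub>G\<^esub> (snd x) \<otimes>\<^bsub>G\<^esub> gs j"
    using g j by (auto simp: i_def translation_less)
  have "translation (snd x) i = j"
    using g j i by (intro translation_eqI) (simp_all flip: G.m_assoc)
  then have "inv_into UNIV (translation (snd x)) j = i"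
    using permutes_inj[OF translation_permutes[OF g]] by (metis inv_f_f)
  then show "codeword (x \<otimes>\<^bsub>E\<^esub> y) $ j
      = (codeword x + permute_vec (translation (snd x)) (codeword y)) $ j"
    using x y j i by (simp add: codeword_def permute_vec_def Phi_mult_nth Phi_nth_closed)
qed (simp add: permute_vec_def)

section \<open>The cocyclic matrix and its code\<close>

definition H :: "'f mat" where
  "H = mat (card (carrier G)) (card (carrier G)) (\<lambda>(i, j). \<phi> (gs i) (gs j))"

lemma normalized_gen_hadamard_H: "normalized_gen_hadamard (card (carrier G)) H"
proof -
  have "card {k. k < card (carrier G) \<and> H $$ (i, k) - H $$ (j, k) = a}
      = card (carrier G) div CARD('f)" if "i < j" "j < card (carrier G)" for i j a
  proof -
    have "gs i \<noteq> gs j"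
      using bij_gs that by (auto simp: bij_betw_def inj_on_def)
    \<comment> \<open>The enumeration transfers the count from elements of \<open>G\<close> to
      column indices.\<close>
    have "bij_betw gs {k \<in> {..<card (carrier G)}. \<phi> (gs i) (gs k) - \<phi> (gs j) (gs k) = a}
      {x \<in> carrier G. \<phi> (gs i) x - \<phi> (gs j) x = a}"
      using bij_gs by (auto simp: bij_betw_def inj_on_def)
    moreover have "{k. k < card (carrier G) \<and> H $$ (i, k) - H $$ (j, k) = a}
        = {k \<in> {..<card (carrier G)}. \<phi> (gs i) (gs k) - \<phi> (gs j) (gs k) = a}"
      using that by (auto simp: H_def)
    ultimately show ?thesis
      using row_difference_balanced[of "gs i" "gs j" a] \<open>gs i \<noteq> gs j\<close> that bij_betw_same_card
      by fastforce
  qed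
  \<comment> \<open>The zero first row and column come from \<open>gs 0 = 1\<close> and the
    normalization of the cocycle.\<close>
  then show ?thesis
    using dvd card_pos
    by (auto simp: normalized_gen_hadamard_def gen_hadamard_def H_def gs_0)
qed

text \<open>A codeword over \<open>g\<close> involves the row of \<open>inv g\<close>, so taking
  \<open>g = inv (gs i)\<close> produces row \<open>i\<close> up to a constant.\<close>

lemma codeword_eq_row:
  assumes "k \<in> carrier K" "i < card (carrier G)"
  shows "codeword (k, inv\<^bsub>G\<^esub> (gs i))
    = row H i + const_vec (card (carrier G)) (- (\<tau> k + \<phi> (inv\<^bsub>G\<^esub> (gs i)) (gs i)))"
  using assms by (intro eq_vecI) (auto simp: codeword_nth H_def const_vec_def)

lemma hadamard_code_H: "hadamard_code (card (carrier G)) H = codeword ` carrier E"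
proof
  show "hadamard_code (card (carrier G)) H \<subseteq> codeword ` carrier E"
  proof
    fix c assume "c \<in> hadamard_code (card (carrier G)) H"
    then obtain a i where i: "i < card (carrier G)"
      and c: "c = row H i + const_vec (card (carrier G)) a"
      by (auto simp: hadamard_code_def rows_def H_def)
    \<comment> \<open>The \<open>K\<close>-component solves
      \<open>- (\<tau> k + \<phi> (inv (gs i)) (gs i)) = a\<close> for \<open>k\<close>.\<close>
    have "c = codeword (\<theta> (- a - \<phi> (inv\<^bsub>G\<^esub> (gs i)) (gs i)), inv\<^bsub>G\<^esub> (gs i))"
      using i by (simp add: codeword_eq_row c)
    then show "c \<in> codeword ` carrier E"
      using i by (metis G.inv_closed \<theta>_closed carrier_E gs_closed imageI)
  qed
  show "codeword ` carrier E \<subseteq> hadamard_code (card (carrier G)) H"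
  proof clarify
    fix k g assume "(k, g) \<in> carrier E"
    then have "k \<in> carrier K" "g \<in> carrier G"
      by auto
    moreover obtain i where i: "i < card (carrier G)" "gs i = inv\<^bsub>G\<^esub> g"
      using gs_surj \<open>g \<in> carrier G\<close> by (metis G.inv_closed)
    ultimately have "codeword (k, g)
        = row H i + const_vec (card (carrier G)) (- (\<tau> k + \<phi> g (gs i)))"
      using codeword_eq_row[of k i] by simp
    moreover have "row H i \<in> set (rows H)"
      using i(1) nth_mem[of i "rows H"] by (simp add: H_def del: row_mat)
    ultimately show "codeword (k, g) \<in> hadamard_code (card (carrier G)) H"
      by (auto simp: hadamard_code_def)
  qed
qed

section \<open>The full propelinear structure\<close>

lemma full_propelinear_codewords:
  "full_propelinear (card (carrier G)) (codeword ` carrier E) (Phi_star G K \<psi> gs \<theta>)"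
proof -
  \<comment> \<open>By injectivity a codeword determines its element of \<open>E\<close>; the
    permutation depends only on the \<open>G\<close>-component.\<close>
  define \<pi> where "\<pi> c = translation (snd (inv_into (carrier E) codeword c))" for c
  have \<pi>: "\<pi> (codeword x) = translation (snd x)" if "x \<in> carrier E" for x
    using that inj_on_codeword by (simp add: \<pi>_def)
  have snd_closed: "snd x \<in> carrier G" if "x \<in> carrier E" for x
    using that by (cases x) simp
  have snd_mult: "snd (x \<otimes>\<^bsub>E\<^esub> y) = snd x \<otimes>\<^bsub>G\<^esub> snd y" for x y
    by (cases x; cases y) simp
  have "codeword \<one>\<^bsub>E\<^esub> = 0\<^sub>v (card (carrier G))"
    by (intro eq_vecI) (auto simp: one_E codeword_nth)
  then have zero: "0\<^sub>v (card (carrier G)) \<in> codeword ` carrier E"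
    by (metis E.one_closed imageI)
  have translate: "Phi_star G K \<psi> gs \<theta> (codeword x) ` codeword ` carrier E = codeword ` carrier E"
    if x: "x \<in> carrier E" for x
  proof -
    have "Phi_star G K \<psi> gs \<theta> (codeword x) ` codeword ` carrier E
        = codeword ` (\<lambda>y. x \<otimes>\<^bsub>E\<^esub> y) ` carrier E"
      unfolding image_image using x by (intro image_cong refl Phi_star_codeword)
    \<comment> \<open>Left multiplication by a group element is onto, which gives condition
      (i).\<close>
    also have "(\<lambda>y. x \<otimes>\<^bsub>E\<^esub> y) ` carrier E = carrier E"
      using x by (rule E.surj_const_mult)
    finally show ?thesis .
  qed
  \<comment> \<open>Condition (ii): both the projection of \<open>E\<close> to \<open>G\<close> and
    \<open>translation\<close> are multiplicative.\<close>
  have hom: "\<pi> (Phi_star G K \<psi> gs \<theta> (codeword x) (codeword y)) = \<pi> (codeword x) \<circ> \<pi> (codeword y)"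
    if "x \<in> carrier E" "y \<in> carrier E" for x y
    using that by (simp only: Phi_star_codeword \<pi> snd_mult snd_closed translation_mult E.m_closed)
  show ?thesis
    unfolding full_propelinear_def
  proof (intro conjI exI[of _ \<pi>] ballI impI allI)
    show "codeword ` carrier E \<subseteq> carrier_vec (card (carrier G))"
      by (auto intro: carrier_vecI)
    show "0\<^sub>v (card (carrier G)) \<in> codeword ` carrier E"
      by (fact zero)
  next
    fix c assume "c \<in> codeword ` carrier E"
    then obtain x where c: "c = codeword x" and x: "x \<in> carrier E"
      by (rule imageE)
    show "\<pi> c permutes {..<card (carrier G)}"
      using x by (simp only: c \<pi> snd_closed translation_permutes)
    show "Phi_star G K \<psi> gs \<theta> c ` codeword ` carrier E = codeword ` carrier E"
      using x by (simp only: c translate)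
    \<comment> \<open>A nonconstant codeword has \<open>snd x\<close> different from
      \<open>1\<close>, and such a translation has no fixed index.\<close>
    show "\<pi> c i \<noteq> i"
      if "c \<notin> range (const_vec (card (carrier G)))" "i < card (carrier G)" for i
      using that x translation_fixes[of "snd x" i]
      by (simp only: c \<pi> codeword_constant_iff snd_closed) blast
    show "\<pi> c = id" if "c \<in> range (const_vec (card (carrier G)))"
      using that x by (simp only: c \<pi> codeword_constant_iff translation_one)
    fix d assume "d \<in> codeword ` carrier E"
    then obtain y where d: "d = codeword y" and y: "y \<in> carrier E"
      by (rule imageE)
    show "Phi_star G K \<psi> gs \<theta> c d = c + permute_vec (\<pi> c) d"
      using x y by (simp only: c d \<pi> Phi_star_codeword codeword_mult)
    show "\<pi> (Phi_star G K \<psi> gs \<theta> c d) = \<pi> c \<circ> \<pi> d"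
      using x y by (simp only: c d hom)
  qed
qed

lemma GHFP_code_Phi_code:
  "GHFP_code (card (carrier G)) (Phi_code G K \<psi> gs \<theta>) (Phi_star G K \<psi> gs \<theta>)"
  using normalized_gen_hadamard_H hadamard_code_H full_propelinear_codewords
  by (auto simp: GHFP_code_def gen_hadamard_code_def Phi_code_eq)

end

text \<open>Commutativity of field addition is carried to \<open>K\<close> by
  \<open>\<theta>\<close>; the locales need \<open>K\<close> commutative, while the theorem only
  assumes a group.\<close>

lemma comm_group_iso_additive_group:
  assumes "group K" "\<theta> \<in> iso additive_group K"
  shows "comm_group K"
proof -
  have "x \<otimes>\<^bsub>K\<^esub> y = y \<otimes>\<^bsub>K\<^esub> x" if "x \<in> carrier K" "y \<in> carrier K" for x y
  proof -
    have "x \<in> range \<theta>" "y \<in> range \<theta>"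
      using that assms(2) by (simp_all add: iso_def additive_group_def bij_betw_def)
    then obtain a b where xy: "x = \<theta> a" "y = \<theta> b"
      by (elim rangeE)
    have "\<theta> (c + d) = \<theta> c \<otimes>\<^bsub>K\<^esub> \<theta> d" for c d
      using assms(2) by (simp add: iso_def hom_def additive_group_def)
    from this[of a b] this[of b a] show ?thesis
      by (simp add: xy add.commute)
  qed
  with assms(1) show ?thesis
    by (rule group.group_comm_groupI)
qed

theorem proposition3p7:
  fixes G :: "('g, 'b) monoid_scheme"
    and K :: "('k, 'c) monoid_scheme"
    and \<theta> :: "'f::{field, finite} \<Rightarrow> 'k"
    and \<psi> :: "'g \<Rightarrow> 'g \<Rightarrow> 'k"
    and gs :: "nat \<Rightarrow> 'g"
    and v :: nat
  assumes "group K"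
    and "\<theta> \<in> iso additive_group K"
    and "group G"
    and "finite (carrier G)"
    and "card (carrier G) = v"
    and "CARD('f) dvd v"
    and "bij_betw gs {..<v} (carrier G)"
    and "gs 0 = \<one>\<^bsub>G\<^esub>"
    and "normalized_cocycle G K \<psi>"
    and "orthogonal_cocycle G K \<psi>"
  shows "GHFP_code v (Phi_code G K \<psi> gs \<theta>) (Phi_star G K \<psi> gs \<theta>)"
proof -
  interpret K: comm_group K
    using assms(1,2) by (rule comm_group_iso_additive_group)
  interpret G: group G
    by fact
  interpret orthogonal_extension G K \<psi> gs \<theta>
    by unfold_locales (simp_all only: assms)
  show ?thesis
    using GHFP_code_Phi_code assms(5) by simp
qed

end
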